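(* Let $k\geqslant 1$ and $m\geqslant 1$ be integers such that $m$ is not divisible by $k$. Then $R_k(km)=(k-1)m$.
   Context: A set $A\subset \mathbb{Z}/n\mathbb{Z}$ is called $k$-free if for all $x\in A$, $kx\notin A$. $R_k(n)$ denotes the maximal cardinality of a $k$-free subset of $\mathbb{Z}/n\mathbb{Z}$. *)

theory Defs
  imports "HOL-Number_Theory.Residues"
begin

text \<open>The group \<open>\<int>/n\<int>\<close> is the additive part of \<^const>\<open>residue_ring\<close>, with carrier \<open>{0..n - 1}\<close>;
  \<open>k x\<close> is the \<open>k\<close>-fold sum of \<open>x\<close> in it.\<close>

definition k_free :: "nat \<Rightarrow> nat \<Rightarrow> int set \<Rightarrow> bool" where
  "k_free k n A \<longleftrightarrow>
     A \<subseteq> carrier (residue_ring (int n)) \<and>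
     (\<forall>x\<in>A. [k] \<cdot>\<^bsub>residue_ring (int n)\<^esub> x \<notin> A)"

lemma add_pow_residue_ring:
  "[(k::nat)] \<cdot>\<^bsub>residue_ring (int n)\<^esub> x = (int k * x) mod int n"
proof (induction k)
  case 0
  then show ?case
    by (simp add: add_pow_def residue_ring_def nat_pow_def)
next
  case (Suc k)
  then show ?case
    by (simp add: add_pow_def residue_ring_def nat_pow_def mod_simps algebra_simps)
qed

definition R_max :: "nat \<Rightarrow> nat \<Rightarrow> nat" where
  "R_max k n = Max {card A | A. k_free k n A}"

text \<open>The maximum is taken over a finite nonempty set, so \<^const>\<open>Max\<close> is meaningful.\<close>

lemma finite_k_free_cards: "finite {card A | A. k_free k n A}"
proof -
  have "finite (Pow (carrier (residue_ring (int n))))"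
    by (simp add: residue_ring_def)
  then have "finite (card ` Pow (carrier (residue_ring (int n))))"
    by (rule finite_imageI)
  then show ?thesis
    by (rule rev_finite_subset) (auto simp: k_free_def)
qed

lemma k_free_cards_nonempty: "{card A | A. k_free k n A} \<noteq> {}"
proof -
  have "k_free k n {}"
    by (simp add: k_free_def)
  then show ?thesis
    by blast
qed

end

theory Submission imports Defs begin

text \<open>Write \<open>n = k m\<close>. The residues not divisible by \<open>k\<close> form a \<open>k\<close>-free set of size \<open>(k - 1) m\<close>.
  Conversely, let \<open>A\<close> be \<open>k\<close>-free. A multiple \<open>y = k q\<close> of \<open>k\<close> in \<open>A\<close> has both \<open>q\<close> and \<open>q + m\<close> as
  preimages under multiplication by \<open>k\<close>. These lie outside \<open>A\<close>, and one of them is not divisible by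
  \<open>k\<close>, since \<open>m\<close> is not. So multiplication by \<open>k\<close> maps the non-multiples of \<open>k\<close> outside \<open>A\<close> onto
  a set that contains the multiples of \<open>k\<close> in \<open>A\<close>.\<close>

definition non_multiples :: "nat \<Rightarrow> nat \<Rightarrow> int set" where
  "non_multiples k n = {x \<in> {0..<int n}. \<not> int k dvd x}"

lemma finite_non_multiples [simp]: "finite (non_multiples k n)"
  by (rule finite_subset [of _ "{0..<int n}"]) (auto simp: non_multiples_def)

lemma k_free_iff:
  "k_free k n A \<longleftrightarrow> A \<subseteq> {0..<int n} \<and> (\<forall>x\<in>A. (int k * x) mod int n \<notin> A)"
proof -
  have "carrier (residue_ring (int n)) = {0..<int n}"
    by (auto simp: residue_ring_def)
  then show ?thesis
    by (simp add: k_free_def add_pow_residue_ring)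
qed

text \<open>Reduction modulo \<open>k * m\<close> preserves divisibility by \<open>k\<close>, so
  every product \<open>k x\<close> falls outside the set.\<close>

lemma k_free_non_multiples: "k_free k (k * m) (non_multiples k (k * m))"
  by (auto simp: k_free_iff non_multiples_def mod_mult_mult1)

text \<open>Counted through the complement: the multiples of \<open>k\<close> in range are an
  injective image of \<open>{0..<int m}\<close>.\<close>

lemma card_non_multiples:
  assumes "k \<ge> 1"
  shows "card (non_multiples k (k * m)) = (k - 1) * m"
proof -
  have multiples: "{x \<in> {0..<int (k * m)}. int k dvd x} = (*) (int k) ` {0..<int m}"
    using assms by (auto simp: zero_le_mult_iff elim!: dvdE)
  have "inj_on ((*) (int k)) {0..<int m}"
    using assms by (auto simp: inj_on_def)
  then have card_multiples: "card ((*) (int k) ` {0..<int m}) = m"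
    by (simp add: card_image)
  have "non_multiples k (k * m) = {0..<int (k * m)} - (*) (int k) ` {0..<int m}"
    unfolding multiples [symmetric] by (auto simp: non_multiples_def)
  moreover have "(*) (int k) ` {0..<int m} \<subseteq> {0..<int (k * m)}"
    unfolding multiples [symmetric] by auto
  ultimately have "card (non_multiples k (k * m)) = k * m - m"
    by (simp add: card_Diff_subset card_multiples flip: of_nat_mult)
  then show ?thesis
    by (simp add: diff_mult_distrib)
qed

lemma multiple_eq_mult_non_multiple:
  assumes "\<not> k dvd m" and "k \<ge> 1" and "y \<in> {0..<int (k * m)}" and "int k dvd y"
  obtains x where "x \<in> non_multiples k (k * m)" and "(int k * x) mod int (k * m) = y"
proof -
  from assms obtain q where y: "y = int k * q" by (auto elim: dvdE)
  have q: "0 \<le> q" "q < int m"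
    using assms by (auto simp: y zero_le_mult_iff)
  \<comment> \<open>Since 1 divides \<open>m\<close>, in fact k \<ge> 2. Hence q + m < 2 m \<le> k
    m, so the second preimage is in range without reduction.\<close>
  have "k \<noteq> 1" using assms(1) by auto
  then have "int m * 2 \<le> int m * int k"
    using assms(2) by (intro mult_left_mono) auto
  then have bound: "q + int m < int (k * m)"
    using q unfolding of_nat_mult mult.commute [of "int k"] by linarith
  show ?thesis
  proof (cases "int k dvd q")
    case False
    then show ?thesis
      using that [of q] q bound by (simp add: non_multiples_def y mod_mult_mult1)
  next
    case True
    then have "\<not> int k dvd q + int m"
      using assms(1) by (simp add: dvd_add_right_iff)
    then show ?thesis
      using that [of "q + int m"] q bound by (simp add: non_multiples_def y mod_mult_mult1)
  qed
qed

lemma card_k_free_le: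
  assumes "\<not> k dvd m" and "k \<ge> 1" and "k_free k (k * m) A"
  shows "card A \<le> card (non_multiples k (k * m))"
proof -
  let ?C = "non_multiples k (k * m)"
  have A: "A \<subseteq> {0..<int (k * m)}"
    and free: "\<And>x. x \<in> A \<Longrightarrow> (int k * x) mod int (k * m) \<notin> A"
    using assms(3) by (auto simp: k_free_iff)
  have "A - ?C \<subseteq> (\<lambda>x. (int k * x) mod int (k * m)) ` (?C - A)"
  proof
    fix y assume y: "y \<in> A - ?C"
    then have "y \<in> {0..<int (k * m)}" "int k dvd y"
      using A by (auto simp: non_multiples_def)
    then obtain x where "x \<in> ?C" and x: "(int k * x) mod int (k * m) = y"
      using multiple_eq_mult_non_multiple assms(1,2) by blast
    moreover have "x \<notin> A"
      using free x y by blast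
    ultimately show "y \<in> (\<lambda>x. (int k * x) mod int (k * m)) ` (?C - A)"
      by blast
  qed
  then have le: "card (A - ?C) \<le> card (?C - A)"
    by (intro surj_card_le) auto
  have "finite A"
    using A finite_subset by blast
  \<comment> \<open>The common part of \<open>A\<close> and \<open>?C\<close> cancels, so comparing
    the two differences suffices.\<close>
  then have "card A = card (A \<inter> ?C) + card (A - ?C)"
    by (simp add: card_Int_Diff)
  also have "\<dots> \<le> card (?C \<inter> A) + card (?C - A)"
    using le by (simp add: Int_commute)
  also have "\<dots> = card ?C"
    by (rule card_Int_Diff [symmetric]) simp
  finally show ?thesis .
qed

theorem theorem2:
  fixes k m :: nat
  assumes "k \<ge> 1" and "m \<ge> 1" and "\<not> k dvd m"
  shows "R_max k (k * m) = (k - 1) * m"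
  unfolding R_max_def
proof (rule Max_eqI)
  show "finite {card A |A. k_free k (k * m) A}"
    by (rule finite_k_free_cards)
next
  fix c assume "c \<in> {card A |A. k_free k (k * m) A}"
  then show "c \<le> (k - 1) * m"
    using card_k_free_le assms(1,3) card_non_multiples by fastforce
next
  show "(k - 1) * m \<in> {card A |A. k_free k (k * m) A}"
    using k_free_non_multiples card_non_multiples [OF assms(1)]
    by (metis (mono_tags, lifting) mem_Collect_eq)
qed

end
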